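(* Let $N \geq 1$ be an integer, let $\delta \in (0,1)$, and put $\theta = \frac{9}{8 \ln \frac{2}{\delta}}$. For $k = 0, 1, \dots, N$ define $$\mathcal{L}(k) = \frac{k}{N} + \frac{3}{4} \cdot \frac{1 - \frac{2k}{N} - \sqrt{1 + 4\theta k \left(1 - \frac{k}{N}\right)}}{1 + \theta N}, \qquad \mathcal{U}(k) = \frac{k}{N} + \frac{3}{4} \cdot \frac{1 - \frac{2k}{N} + \sqrt{1 + 4\theta k \left(1 - \frac{k}{N}\right)}}{1 + \theta N}.$$ Let $p \in (0,1)$ and let $K$ be the number of successes in $N$ i.i.d. Bernoulli trials with success probability $p$, i.e. $K$ is a binomial random variable with parameters $N$ and $p$. Then $$\Pr\left\{ \mathcal{L}(K) < p < \mathcal{U}(K) \right\} > 1 - \delta.$$ Moreover, for $k \in \{0, 1, \dots, N\}$, $$\mathcal{L}(k) < L_{N,k,\delta} < U_{N,k,\delta} < \mathcal{U}(k),$$ where $L_{N,k,\delta}$ and $U_{N,k,\delta}$ are the Clopper-Pearson lower and upper confidence limits.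
   Context: Clopper-Pearson confidence limits: for an integer $N \geq 1$, $\delta \in (0,1)$ and $k \in \{0,1,\dots,N\}$, set $L_{N,k,\delta} = 0$ if $k = 0$, and $L_{N,k,\delta} = \underline{p}$ if $k > 0$, where $\underline{p} \in (0,1)$ is the solution of $\sum_{j=0}^{k-1} \binom{N}{j} \underline{p}^j (1-\underline{p})^{N-j} = 1 - \frac{\delta}{2}$. Set $U_{N,k,\delta} = 1$ if $k = N$, and $U_{N,k,\delta} = \overline{p}$ if $k < N$, where $\overline{p} \in (0,1)$ is the solution of $\sum_{j=0}^{k} \binom{N}{j} \overline{p}^j (1-\overline{p})^{N-j} = \frac{\delta}{2}$.
   Formalization: The first inequality of the chain is strict only for k ≠ 0 and the last only for k ≠ N; at k = 0 and k = N respectively they are stated as ≤, because L(0) = L_{N,0,δ} = 0 and U(N) = U_{N,N,δ} = 1, so strictness fails there. *)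

theory Defs
  imports "HOL-Probability.Probability"
begin

definition theta :: "real \<Rightarrow> real" where
  "theta \<delta> = 9 / (8 * ln (2 / \<delta>))"

definition lower_limit :: "nat \<Rightarrow> real \<Rightarrow> nat \<Rightarrow> real" where
  "lower_limit N \<delta> k = real k / real N + 3 / 4 *
     ((1 - 2 * real k / real N - sqrt (1 + 4 * theta \<delta> * real k * (1 - real k / real N)))
       / (1 + theta \<delta> * real N))"

definition upper_limit :: "nat \<Rightarrow> real \<Rightarrow> nat \<Rightarrow> real" where
  "upper_limit N \<delta> k = real k / real N + 3 / 4 *
     ((1 - 2 * real k / real N + sqrt (1 + 4 * theta \<delta> * real k * (1 - real k / real N)))
       / (1 + theta \<delta> * real N))"

definition CP_lower :: "nat \<Rightarrow> nat \<Rightarrow> real \<Rightarrow> real" where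
  "CP_lower N k \<delta> = (if k = 0 then 0 else
     (THE p. 0 < p \<and> p < 1 \<and>
        (\<Sum>j<k. real (N choose j) * p ^ j * (1 - p) ^ (N - j)) = 1 - \<delta> / 2))"

definition CP_upper :: "nat \<Rightarrow> nat \<Rightarrow> real \<Rightarrow> real" where
  "CP_upper N k \<delta> = (if k = N then 1 else
     (THE p. 0 < p \<and> p < 1 \<and>
        (\<Sum>j\<le>k. real (N choose j) * p ^ j * (1 - p) ^ (N - j)) = \<delta> / 2))"

(* At k = 0 the two lower limits coincide, and at k = N the two upper limits do, so a
   comparison of the explicit with the Clopper-Pearson limits cannot be strict there. *)

lemma lower_limit_0: "lower_limit N \<delta> 0 = CP_lower N 0 \<delta>"
  by (simp add: lower_limit_def CP_lower_def)

lemma upper_limit_N: "N \<ge> 1 \<Longrightarrow> upper_limit N \<delta> N = CP_upper N N \<delta>"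
  by (simp add: upper_limit_def CP_upper_def)

end

theory Submission
  imports Defs
begin

text \<open>
  A Chernoff bound sharpened by Massart's inequality shows that the binomial tail at \<open>k\<close> is below
  \<open>\<delta> / 2\<close> for every success probability outside the explicit limits, and the Clopper-Pearson
  limits are the probabilities at which this tail equals \<open>\<delta> / 2\<close>. For the coverage, apply the tail
  bound at the extreme values of \<open>K\<close> whose interval misses \<open>p\<close>; monotonicity of the limits in \<open>k\<close>
  is not needed. The lower side follows from the upper one by exchanging successes and failures.
\<close>

text \<open>Since \<open>ln 0 = 0\<close> in HOL, \<open>cross_ent 0 0 = 0\<close> is the correct limit value.\<close>
definition cross_ent :: "real \<Rightarrow> real \<Rightarrow> real" where
  "cross_ent z t = z * ln t + (1 - z) * ln (1 - t)"

definition binom_cdf :: "nat \<Rightarrow> nat \<Rightarrow> real \<Rightarrow> real" where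
  "binom_cdf N k p = (\<Sum>j\<le>k. real (N choose j) * p ^ j * (1 - p) ^ (N - j))"

section \<open>Massart's inequality for the relative entropy of Bernoulli laws\<close>

text \<open>\<open>1 / s\<close> is convex and decreasing and \<open>t * (1 - t)\<close> is concave,
  so their composite is convex; the left side is its tangent at \<open>q\<close>. Dropping
  \<open>(t - q)\<^sup>2\<close> is the strict step, and what remains is the tangent of
  \<open>1 / s\<close> at \<open>a\<close>.\<close>

lemma inverse_parabola_tangent:
  fixes q t :: real
  assumes "0 < q" "q < 1" "0 < t" "t < 1" "t \<noteq> q"
  shows "1 / (q * (1 - q)) + (2 * q - 1) / (q * (1 - q))\<^sup>2 * (t - q) < 1 / (t * (1 - t))"
proof -
  define a b where "a = q * (1 - q)" and "b = t * (1 - t)"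
  have pos: "a > 0" "b > 0"
    using assms by (auto simp: a_def b_def)
  have b: "b = a + (1 - 2 * q) * (t - q) - (t - q)\<^sup>2"
    by (simp add: a_def b_def power2_eq_square algebra_simps)
  have "1 / a + (2 * q - 1) / a\<^sup>2 * (t - q) = (2 * a - b - (t - q)\<^sup>2) / a\<^sup>2"
    using pos unfolding b by (simp add: divide_simps power2_eq_square) (simp add: algebra_simps)
  also have "\<dots> < (2 * a - b) / a\<^sup>2"
    using pos assms by (intro divide_strict_right_mono) auto
  also have "\<dots> \<le> 1 / b"
  proof -
    have "(2 * a - b) * b \<le> a\<^sup>2"
      using zero_le_power2[of "a - b"] by (simp add: power2_eq_square algebra_simps)
    then show ?thesis
      using pos by (simp add: divide_simps)
  qed
  finally show ?thesis
    by (simp add: a_def b_def)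
qed

text \<open>
  The difference is the integral of \<open>(t - z) / (t * (1 - t))\<close> over \<open>{z..p}\<close>. The point \<open>q\<close> is the
  barycentre of the weight \<open>t - z\<close>, so Jensen's inequality for \<open>1 / (t * (1 - t))\<close> applies; below,
  the function \<open>G\<close> integrates the tangent inequality at \<open>q\<close>, whose linear part vanishes at \<open>p\<close>.
\<close>
lemma cross_ent_gap:
  fixes z p q :: real
  assumes "0 \<le> z" "z < p" "p < 1" and q: "q = (2 * p + z) / 3"
  shows "(p - z)\<^sup>2 / (2 * (q * (1 - q))) < cross_ent z z - cross_ent z p"
proof -
  define a c where "a = q * (1 - q)" and "c = (2 * q - 1) / a\<^sup>2"
  define G where "G t = - cross_ent z t
    - ((t - z)\<^sup>2 / (2 * a) + c * ((t - z) ^ 3 / 3 - (q - z) * (t - z)\<^sup>2 / 2))" for t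
  have zq: "z < q" "q < p" "0 < q" "q < 1"
    using assms by auto
  have a: "a > 0"
    using zq by (simp add: a_def)
  have deriv: "\<exists>y. (G has_real_derivative y) (at t) \<and> y > 0"
    if t: "z < t" "t < p" "t \<noteq> q" for t
  proof -
    have t01: "0 < t" "t < 1"
      using t assms by auto
    have eq: "- (z / t - (1 - z) / (1 - t)) = (t - z) * (1 / (t * (1 - t)))"
      using t01 by (simp add: divide_simps) (simp add: algebra_simps)
    have D: "(G has_real_derivative
        (- (z / t - (1 - z) / (1 - t)) - ((t - z) / a + c * ((t - z)\<^sup>2 - (q - z) * (t - z))))) (at t)"
      unfolding G_def cross_ent_def
      by (rule derivative_eq_intros refl | use t01 a in \<open>simp add: field_simps power2_eq_square\<close>)+
    have "- (z / t - (1 - z) / (1 - t)) - ((t - z) / a + c * ((t - z)\<^sup>2 - (q - z) * (t - z)))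
       = (t - z) * (1 / (t * (1 - t)) - (1 / a + c * (t - q)))"
      unfolding eq by (simp add: power2_eq_square algebra_simps diff_divide_distrib)
    moreover have "(t - z) * (1 / (t * (1 - t)) - (1 / a + c * (t - q))) > 0"
      using inverse_parabola_tangent[of q t] t t01 zq
      by (intro mult_pos_pos) (auto simp: a_def c_def)
    ultimately show ?thesis
      using D by metis
  qed
  have cont: "continuous_on {z..p} G"
  \<comment> \<open>For \<open>z = 0\<close> the interval contains the singularity of
    \<open>ln t\<close>, but the coefficient of \<open>ln t\<close> is 0.\<close>
  proof (cases "z = 0")
    case True
    then show ?thesis
      using assms a unfolding G_def cross_ent_def by (auto intro!: continuous_intros)
  next
    case False
    then show ?thesis
      using assms a unfolding G_def cross_ent_def by (auto intro!: continuous_intros)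
  qed
  \<comment> \<open>The derivative of \<open>G\<close> vanishes at \<open>q\<close>, where the
    tangent touches, so strict increase is shown on each side of \<open>q\<close>.\<close>
  have "G z < G q"
    using zq by (intro DERIV_pos_imp_increasing_open[of z q G] deriv continuous_on_subset[OF cont]) auto
  also have "G q < G p"
    using zq by (intro DERIV_pos_imp_increasing_open[of q p G] deriv continuous_on_subset[OF cont]) auto
  finally have "G z < G p" .
  \<comment> \<open>This holds because \<open>q - z = 2 * (p - z) / 3\<close>.\<close>
  moreover have "(p - z) ^ 3 / 3 - (q - z) * (p - z)\<^sup>2 / 2 = 0"
    by (simp add: q power2_eq_square power3_eq_cube field_simps)
  ultimately show ?thesis
    by (simp add: G_def a_def)
qed

section \<open>Chernoff bound for the lower binomial tail\<close>

lemma binom_cdf_le_1: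
  assumes "0 \<le> p" "p \<le> 1" "k \<le> N"
  shows "binom_cdf N k p \<le> 1"
proof -
  have "binom_cdf N k p \<le> (\<Sum>j\<le>N. real (N choose j) * p ^ j * (1 - p) ^ (N - j))"
    unfolding binom_cdf_def using assms by (intro sum_mono2) auto
  also have "\<dots> = 1"
    using binomial_ring[of p "1 - p" N] by simp
  finally show ?thesis .
qed

text \<open>Change of measure: the density of success probability \<open>p\<close> relative to \<open>z < p\<close> increases in \<open>j\<close>,
  so on the lower tail it is at most its value at \<open>j = k\<close>.\<close>
lemma binom_cdf_chernoff:
  fixes N k :: nat and p :: real
  assumes "k < N" "real k / real N < p" "p < 1"
  shows "binom_cdf N k p \<le>
    exp (- (real N * (cross_ent (real k / real N) (real k / real N) - cross_ent (real k / real N) p)))"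
proof -
  define z where "z = real k / real N"
  have N: "N > 0" and k: "real k = N * z" and z: "0 \<le> z" "z < p" "z < 1" and p: "0 < p"
    using assms by (auto simp: z_def field_simps intro: le_less_trans[of 0 "real k / real N"])
  define E where "E = exp (- (real N * (cross_ent z z - cross_ent z p)))"
  have *: "p ^ j * (1 - p) ^ (N - j) \<le> E * (z ^ j * (1 - z) ^ (N - j))" if "j \<le> k" for j
  \<comment> \<open>With the default \<open>ln 0 = 0\<close> the bound
    \<open>ln z \<le> ln p\<close> fails at \<open>z = 0\<close>. There
    \<open>E = (1 - p) ^ N\<close>, and the claim is an equality.\<close>
  proof (cases "k = 0")
    case True
    then have "z = 0" "j = 0"
      using that by (auto simp: z_def)
    then show ?thesis
      using assms p by (simp add: E_def cross_ent_def ln_realpow[symmetric])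
  next
    case False
    then have z0: "z > 0"
      using N by (simp add: z_def)
    have lnle: "ln z \<le> ln p" "ln (1 - p) \<le> ln (1 - z)"
      using z z0 assms by auto
    have "real j * ln p + real (N - j) * ln (1 - p) \<le>
       - (real N * (cross_ent z z - cross_ent z p)) + (real j * ln z + real (N - j) * ln (1 - z))"
    proof -
      \<comment> \<open>Since \<open>N * z = k\<close>, the two exponents differ by exactly this
        product of \<open>k - j\<close> and the log odds ratio of \<open>p\<close> and
        \<open>z\<close>.\<close>
      have "0 \<le> (real k - real j) * ((ln p - ln z) + (ln (1 - z) - ln (1 - p)))"
        using lnle that by (intro mult_nonneg_nonneg) auto
      moreover have "real (N - j) = real N - real j"
        using that assms by auto
      ultimately show ?thesis
        by (simp add: cross_ent_def k algebra_simps)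
    qed
    then have "exp (real j * ln p + real (N - j) * ln (1 - p)) \<le>
       E * exp (real j * ln z + real (N - j) * ln (1 - z))"
      by (simp only: E_def exp_add[symmetric] exp_le_cancel_iff)
    then show ?thesis
      using p assms z z0 by (simp add: exp_add exp_of_nat_mult)
  qed
  have "binom_cdf N k p \<le> E * binom_cdf N k z"
    unfolding binom_cdf_def sum_distrib_left
  proof (intro sum_mono)
    fix j assume "j \<in> {..k}"
    then have "real (N choose j) * (p ^ j * (1 - p) ^ (N - j)) \<le>
        real (N choose j) * (E * (z ^ j * (1 - z) ^ (N - j)))"
      by (intro mult_left_mono *) auto
    then show "real (N choose j) * p ^ j * (1 - p) ^ (N - j) \<le>
        E * (real (N choose j) * z ^ j * (1 - z) ^ (N - j))"
      by (simp add: mult_ac)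
  qed
  also have "\<dots> \<le> E * 1"
    using z assms by (intro mult_left_mono binom_cdf_le_1) (auto simp: E_def)
  finally show ?thesis
    by (simp add: E_def z_def)
qed

section \<open>The binomial tail as a function of the success probability\<close>

text \<open>The derivatives of the summands telescope: by
  \<open>(k + 1) * (N choose (k + 1)) = (N - k) * (N choose k)\<close>, the gain of each new summand
  cancels what was left of the previous ones.\<close>

lemma binom_cdf_deriv:
  assumes "k < N"
  shows "(binom_cdf N k has_real_derivative
     - (real (N - k) * real (N choose k) * p ^ k * (1 - p) ^ (N - Suc k))) (at p)"
  using assms
proof (induction k)
  case 0
  show ?case
    unfolding binom_cdf_def by (rule derivative_eq_intros refl | simp)+
next
  case (Suc k)
  let ?t = "\<lambda>p. real (N choose Suc k) * p ^ Suc k * (1 - p) ^ (N - Suc k)"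
  have "(?t has_real_derivative
      real (Suc k) * real (N choose Suc k) * p ^ k * (1 - p) ^ (N - Suc k)
      - real (N - Suc k) * real (N choose Suc k) * p ^ Suc k * (1 - p) ^ (N - Suc (Suc k))) (at p)"
    by (rule derivative_eq_intros refl | simp)+
  moreover have "real (Suc k) * real (N choose Suc k) = real (N - k) * real (N choose k)"
  proof -
    have "Suc k * (N choose Suc k) = (N - k) * (N choose k)"
      using binomial_absorb_comp[of N k] binomial_absorption[of k N] Suc.prems by simp
    then show ?thesis
      by (metis of_nat_mult)
  qed
  ultimately have "((\<lambda>p. binom_cdf N k p + ?t p) has_real_derivative
      - (real (N - k) * real (N choose k) * p ^ k * (1 - p) ^ (N - Suc k)) +
      (real (N - k) * real (N choose k) * p ^ k * (1 - p) ^ (N - Suc k)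
      - real (N - Suc k) * real (N choose Suc k) * p ^ Suc k * (1 - p) ^ (N - Suc (Suc k)))) (at p)"
    using Suc by (intro DERIV_add) auto
  then show ?case
    by (simp add: binom_cdf_def[abs_def])
qed

lemma binom_cdf_continuous: "continuous_on A (binom_cdf N k)"
  unfolding binom_cdf_def[abs_def] by (intro continuous_intros)

lemma binom_cdf_strict_antimono:
  assumes "k < N" "0 \<le> p" "p < r" "r \<le> 1"
  shows "binom_cdf N k r < binom_cdf N k p"
proof (rule DERIV_neg_imp_decreasing_open[OF assms(3)])
  fix x assume "p < x" "x < r"
  then show "\<exists>y. (binom_cdf N k has_real_derivative y) (at x) \<and> y < 0"
    using assms by (intro exI[of _ "- (real (N - k) * real (N choose k) * x ^ k * (1 - x) ^ (N - Suc k))"] conjI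
        binom_cdf_deriv) auto
qed (rule binom_cdf_continuous)

lemma binom_cdf_antimono:
  assumes "k < N" "0 \<le> p" "p \<le> r" "r \<le> 1"
  shows "binom_cdf N k r \<le> binom_cdf N k p"
  using binom_cdf_strict_antimono[of k N p r] assms by (cases "p = r") auto

lemma binom_cdf_0: "binom_cdf N k 0 = 1"
  by (simp add: binom_cdf_def power_0_left if_distrib if_distribR cong: if_cong)

lemma binom_cdf_1: "k < N \<Longrightarrow> binom_cdf N k 1 = 0"
  by (auto simp: binom_cdf_def power_0_left intro!: sum.neutral)

text \<open>The tail falls continuously and strictly from 1 at \<open>p = 0\<close> to 0 at
  \<open>p = 1\<close>. This makes the descriptions in \<open>CP_lower\<close> and
  \<open>CP_upper\<close> meaningful.\<close>

lemma binom_cdf_ex1: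
  assumes "k < N" "0 < y" "y < 1"
  shows "\<exists>!p. 0 < p \<and> p < 1 \<and> binom_cdf N k p = y"
proof -
  have "\<exists>x\<ge>0. x \<le> 1 \<and> binom_cdf N k x = y"
    using assms by (intro IVT2' binom_cdf_continuous) (auto simp: binom_cdf_0 binom_cdf_1)
  then obtain x where x: "0 \<le> x" "x \<le> 1" "binom_cdf N k x = y"
    by blast
  then have "x \<noteq> 0" "x \<noteq> 1"
    using assms by (auto simp: binom_cdf_0 binom_cdf_1)
  moreover have "u = v" if "0 < u" "u < 1" "0 < v" "v < 1" "binom_cdf N k u = binom_cdf N k v" for u v
    using that binom_cdf_strict_antimono[OF assms(1), of u v] binom_cdf_strict_antimono[OF assms(1), of v u]
    by (cases u v rule: linorder_cases) auto
  ultimately show ?thesis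
    using x by (intro ex1I[of _ x]) auto
qed

text \<open>The number of failures is binomial with parameter \<open>1 - p\<close>, and at most
  \<open>N - k\<close> failures means at least \<open>k\<close> successes, the complement of at most
  \<open>k - 1\<close>.\<close>

lemma binom_cdf_reflect:
  assumes "0 < k" "k \<le> N"
  shows "binom_cdf N (N - k) (1 - p) = 1 - binom_cdf N (k - 1) p"
proof -
  let ?t = "\<lambda>j. real (N choose j) * p ^ j * (1 - p) ^ (N - j)"
  have "binom_cdf N (N - k) (1 - p) = (\<Sum>j\<in>{k..N}. ?t j)"
    unfolding binom_cdf_def using assms
    by (intro sum.reindex_bij_witness[of _ "\<lambda>j. N - j" "\<lambda>j. N - j"]) (auto simp: binomial_symmetric[symmetric])
  moreover have "(\<Sum>j\<in>{..N}. ?t j) = (\<Sum>j\<in>{..k - 1}. ?t j) + (\<Sum>j\<in>{k..N}. ?t j)"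
    using assms by (subst sum.union_disjoint[symmetric]) (auto intro!: sum.cong)
  moreover have "(\<Sum>j\<in>{..N}. ?t j) = 1"
    using binomial_ring[of p "1 - p" N] by simp
  ultimately show ?thesis
    by (simp add: binom_cdf_def)
qed

section \<open>The tail outside the explicit limits\<close>

text \<open>Replacing \<open>k\<close> by \<open>N - k\<close> fixes the radicand and flips the sign
  of \<open>1 - 2 * k / N\<close>.\<close>

lemma upper_limit_reflect:
  assumes "k \<le> N" "0 < N"
  shows "upper_limit N \<delta> (N - k) = 1 - lower_limit N \<delta> k"
proof -
  have "real (N - k) = real N - real k"
    using assms by auto
  moreover have "4 * theta \<delta> * (real N - real k) * (1 - (real N - real k) / real N)
      = 4 * theta \<delta> * real k * (1 - real k / real N)"
    using assms by (simp add: field_simps)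
  moreover have "1 - 2 * (real N - real k) / real N = - (1 - 2 * real k / real N)"
    "(real N - real k) / real N = 1 - real k / real N"
    using assms by (simp_all add: field_simps)
  ultimately show ?thesis
    by (simp add: upper_limit_def lower_limit_def diff_divide_distrib add_divide_distrib algebra_simps)
qed

text \<open>In terms of \<open>q = (2 * p + k / N) / 3\<close>, the explicit limits are the two roots of
  \<open>theta \<delta> * N * (q - k / N)\<^sup>2 = q * (1 - q)\<close>, i.e. of the equation that makes the exponential bound equal \<open>\<delta> / 2\<close>.\<close>
lemma binom_cdf_above_upper_limit:
  assumes "0 < \<delta>" "\<delta> < 1" "k < N" "upper_limit N \<delta> k \<le> p" "p < 1"
  shows "binom_cdf N k p < \<delta> / 2"
proof -
  define z where "z = real k / real N"
  define q where "q = (2 * p + z) / 3"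
  define n where "n = theta \<delta> * real N"
  define R where "R = sqrt (1 + 4 * n * z * (1 - z))"
  have ln: "ln (2 / \<delta>) > 0"
    using assms by simp
  have N: "N > 0" and z: "0 \<le> z" "z < 1"
    using assms by (auto simp: z_def)
  have n: "n > 0"
    using N ln by (simp add: n_def theta_def)
  have U: "upper_limit N \<delta> k = z + 3 / 4 * ((1 - 2 * z + R) / (1 + n))"
    using N by (simp add: upper_limit_def z_def R_def n_def mult.assoc)
  have R: "R \<ge> 1"
    using n z by (simp add: R_def)
  then have "z < upper_limit N \<delta> k"
    using n z by (simp add: U)
  then have zp: "z < p"
    using assms by simp
  have q01: "0 < q" "q < 1"
    using z zp assms by (auto simp: q_def)
  have R2: "R\<^sup>2 = 1 + 4 * n * z * (1 - z)"
    using n z by (simp add: R_def)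
  \<comment> \<open>Here \<open>p - z = 3 / 2 * (q - z)\<close> absorbs the factor
    \<open>3 / 4\<close> of the limit.\<close>
  have "(1 - 2 * z + R) / (1 + n) \<le> 2 * (q - z)"
    using assms(4) unfolding U q_def by argo
  then have "1 - 2 * z + R \<le> 2 * (q - z) * (1 + n)"
    using n by (simp add: pos_divide_le_eq)
  then have "R \<le> 2 * (q - z) * (1 + n) - (1 - 2 * z)"
    by simp
  \<comment> \<open>Squaring undoes the quadratic formula: the difference of the squares is
    \<open>4 * (1 + n) * (n * (q - z)\<^sup>2 - q * (1 - q))\<close>.\<close>
  then have "R\<^sup>2 \<le> (2 * (q - z) * (1 + n) - (1 - 2 * z))\<^sup>2"
    using R by (intro power_mono) auto
  then have "0 \<le> (1 + n) * (n * (q - z)\<^sup>2 - q * (1 - q))"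
    unfolding R2 by (simp add: power2_eq_square algebra_simps)
  then have root: "q * (1 - q) \<le> n * (q - z)\<^sup>2"
    using n by (simp add: zero_le_mult_iff)
  have "ln (2 / \<delta>) * (q * (1 - q)) \<le> ln (2 / \<delta>) * (n * (q - z)\<^sup>2)"
    using root ln by (intro mult_left_mono) auto
  \<comment> \<open>The constant \<open>9 / 8\<close> in \<open>theta\<close> meets
    \<open>(2 / 3)\<^sup>2\<close> from \<open>q - z\<close>, leaving \<open>1 / 2\<close>.\<close>
  also have "\<dots> = real N * (p - z)\<^sup>2 / 2"
    using ln by (simp add: n_def theta_def q_def power2_eq_square field_simps)
  finally have "ln (2 / \<delta>) \<le> real N * ((p - z)\<^sup>2 / (2 * (q * (1 - q))))"
    using q01 by (simp add: field_simps)
  also have "\<dots> < real N * (cross_ent z z - cross_ent z p)"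
    using cross_ent_gap[OF z(1) zp assms(5) q_def] N by (intro mult_strict_left_mono) auto
  finally have "exp (- (real N * (cross_ent z z - cross_ent z p))) < exp (- ln (2 / \<delta>))"
    by simp
  also have "\<dots> = \<delta> / 2"
    using assms by (simp add: exp_minus)
  finally show ?thesis
    using binom_cdf_chernoff[of k N p] assms zp by (simp add: z_def)
qed

text \<open>Mirror image of the upper bound, taken at \<open>N - k\<close> and \<open>1 - p\<close>;
  \<open>0 < k\<close> becomes \<open>N - k < N\<close>.\<close>

lemma binom_cdf_below_lower_limit:
  assumes "0 < \<delta>" "\<delta> < 1" "0 < k" "k \<le> N" "0 < p" "p \<le> lower_limit N \<delta> k"
  shows "1 - \<delta> / 2 < binom_cdf N (k - 1) p"
  using binom_cdf_above_upper_limit[of \<delta> "N - k" N "1 - p"] upper_limit_reflect[of k N \<delta>]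
    binom_cdf_reflect[of k N p] assms by auto

section \<open>Comparison with the Clopper-Pearson limits\<close>

lemma CP_lower_props:
  assumes "0 < \<delta>" "\<delta> < 1" "0 < k" "k \<le> N"
  shows "0 < CP_lower N k \<delta>" "CP_lower N k \<delta> < 1"
    and "binom_cdf N (k - 1) (CP_lower N k \<delta>) = 1 - \<delta> / 2"
proof -
  have "{..<k} = {..k - 1}"
    using assms by auto
  then have "CP_lower N k \<delta> = (THE p. 0 < p \<and> p < 1 \<and> binom_cdf N (k - 1) p = 1 - \<delta> / 2)"
    using assms by (simp add: CP_lower_def binom_cdf_def)
  then show "0 < CP_lower N k \<delta>" "CP_lower N k \<delta> < 1"
    and "binom_cdf N (k - 1) (CP_lower N k \<delta>) = 1 - \<delta> / 2"
    using theI'[OF binom_cdf_ex1[of "k - 1" N "1 - \<delta> / 2"]] assms by auto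
qed

lemma CP_upper_props:
  assumes "0 < \<delta>" "\<delta> < 1" "k < N"
  shows "0 < CP_upper N k \<delta>" "CP_upper N k \<delta> < 1"
    and "binom_cdf N k (CP_upper N k \<delta>) = \<delta> / 2"
proof -
  have "CP_upper N k \<delta> = (THE p. 0 < p \<and> p < 1 \<and> binom_cdf N k p = \<delta> / 2)"
    using assms by (simp add: CP_upper_def binom_cdf_def)
  then show "0 < CP_upper N k \<delta>" "CP_upper N k \<delta> < 1"
    and "binom_cdf N k (CP_upper N k \<delta>) = \<delta> / 2"
    using theI'[OF binom_cdf_ex1[of k N "\<delta> / 2"]] assms by auto
qed

text \<open>Otherwise the tail at \<open>CP_lower N k \<delta>\<close> would exceed
  \<open>1 - \<delta> / 2\<close>, the value it has by definition.\<close>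

lemma lower_limit_less_CP_lower:
  assumes "0 < \<delta>" "\<delta> < 1" "0 < k" "k \<le> N"
  shows "lower_limit N \<delta> k < CP_lower N k \<delta>"
  using binom_cdf_below_lower_limit[OF assms, of "CP_lower N k \<delta>"] CP_lower_props[OF assms] by force

lemma CP_upper_less_upper_limit:
  assumes "0 < \<delta>" "\<delta> < 1" "k < N"
  shows "CP_upper N k \<delta> < upper_limit N \<delta> k"
  using binom_cdf_above_upper_limit[OF assms, of "CP_upper N k \<delta>"] CP_upper_props[OF assms] by force

text \<open>For \<open>0 < k < N\<close>, the tail up to \<open>k\<close> is at least
  \<open>1 - \<delta> / 2\<close> at the lower limit and equals the smaller
  \<open>\<delta> / 2\<close> at the upper one; the tail decreases in \<open>p\<close>. At the ends
  one limit is 0 or 1 and the other lies strictly between.\<close>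

lemma CP_lower_less_CP_upper:
  assumes "0 < \<delta>" "\<delta> < 1" "0 < N" "k \<le> N"
  shows "CP_lower N k \<delta> < CP_upper N k \<delta>"
proof (cases "k = 0 \<or> k = N")
  case True
  then show ?thesis
    using CP_lower_props[of \<delta> k N] CP_upper_props[of \<delta> k N] assms
    by (auto simp: CP_lower_def CP_upper_def)
next
  case False
  then have k: "0 < k" "k < N"
    using assms by auto
  note lo = CP_lower_props[OF assms(1,2) k(1) assms(4)] and up = CP_upper_props[OF assms(1,2) k(2)]
  have "binom_cdf N (k - 1) (CP_lower N k \<delta>) \<le> binom_cdf N k (CP_lower N k \<delta>)"
    unfolding binom_cdf_def using lo by (intro sum_mono2) auto
  then have "binom_cdf N k (CP_upper N k \<delta>) < binom_cdf N k (CP_lower N k \<delta>)"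
    using lo up assms by simp
  then show ?thesis
    using binom_cdf_antimono[OF k(2), of "CP_upper N k \<delta>" "CP_lower N k \<delta>"] lo up by force
qed

section \<open>Coverage probability\<close>

lemma binomial_pmf_prob_atMost:
  assumes "0 \<le> p" "p \<le> 1"
  shows "measure_pmf.prob (binomial_pmf N p) {..k} = binom_cdf N k p"
  using assms by (simp add: measure_measure_pmf_finite binom_cdf_def)

lemma binomial_pmf_prob_upper_limit_le:
  assumes "0 < \<delta>" "\<delta> < 1" "0 < N" "0 < p" "p < 1"
  shows "measure_pmf.prob (binomial_pmf N p) {k. upper_limit N \<delta> k \<le> p} < \<delta> / 2"
proof -
  \<comment> \<open>Restricting to the support makes the event finite, so that it has a largest
    element.\<close>
  define S where "S = {k. upper_limit N \<delta> k \<le> p} \<inter> {..N}"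
  have S: "measure_pmf.prob (binomial_pmf N p) {k. upper_limit N \<delta> k \<le> p} = measure_pmf.prob (binomial_pmf N p) S"
    using measure_Int_set_pmf[of "binomial_pmf N p" "{k. upper_limit N \<delta> k \<le> p}"] assms
    by (simp add: S_def set_pmf_binomial)
  have fin: "finite S"
    by (simp add: S_def)
  show ?thesis
  proof (cases "S = {}")
    case True
    then show ?thesis
      using S assms by simp
  next
    case False
    define k where "k = Max S"
    have "k \<in> S"
      using False fin by (simp add: k_def)
    \<comment> \<open>The limit at \<open>N\<close> is 1, above \<open>p\<close>; hence the maximum
      is below \<open>N\<close>, as the tail bound requires.\<close>
    moreover have "N \<notin> S"
      using assms by (simp add: S_def upper_limit_N CP_upper_def)
    ultimately have "k < N" "upper_limit N \<delta> k \<le> p"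
      by (auto simp: S_def order.strict_iff_order)
    then have "binom_cdf N k p < \<delta> / 2"
      using binom_cdf_above_upper_limit assms by blast
    moreover have "measure_pmf.prob (binomial_pmf N p) S \<le> measure_pmf.prob (binomial_pmf N p) {..k}"
      using fin by (intro measure_pmf.finite_measure_mono) (auto simp: k_def)
    ultimately show ?thesis
      using S binomial_pmf_prob_atMost[of p N k] assms by simp
  qed
qed

lemma binomial_pmf_prob_le_lower_limit:
  assumes "0 < \<delta>" "\<delta> < 1" "0 < N" "0 < p" "p < 1"
  shows "measure_pmf.prob (binomial_pmf N p) {k. p \<le> lower_limit N \<delta> k} < \<delta> / 2"
proof -
  define S where "S = {k. p \<le> lower_limit N \<delta> k} \<inter> {..N}"
  have S: "measure_pmf.prob (binomial_pmf N p) {k. p \<le> lower_limit N \<delta> k} = measure_pmf.prob (binomial_pmf N p) S"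
    using measure_Int_set_pmf[of "binomial_pmf N p" "{k. p \<le> lower_limit N \<delta> k}"] assms
    by (simp add: S_def set_pmf_binomial)
  have fin: "finite S"
    by (simp add: S_def)
  show ?thesis
  proof (cases "S = {}")
    case True
    then show ?thesis
      using S assms by simp
  next
    case False
    define k where "k = Min S"
    have "k \<in> S"
      using False fin by (simp add: k_def)
    \<comment> \<open>The limit at 0 is 0, below \<open>p\<close>; hence the minimum is positive and
      \<open>k - 1\<close> is a true predecessor.\<close>
    moreover have "0 \<notin> S"
      using assms by (simp add: S_def lower_limit_0 CP_lower_def)
    ultimately have k: "0 < k" "k \<le> N" "p \<le> lower_limit N \<delta> k"
      by (auto simp: S_def intro: gr0I)
    then have "1 - \<delta> / 2 < binom_cdf N (k - 1) p"
      using binom_cdf_below_lower_limit assms by blast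
    moreover have "measure_pmf.prob (binomial_pmf N p) S \<le> measure_pmf.prob (binomial_pmf N p) (- {..k - 1})"
    proof (intro measure_pmf.finite_measure_mono subsetI)
      fix x assume "x \<in> S"
      then have "k \<le> x"
        using fin by (simp add: k_def)
      then show "x \<in> - {..k - 1}"
        using k by auto
    qed auto
    moreover have "measure_pmf.prob (binomial_pmf N p) (- {..k - 1}) = 1 - binom_cdf N (k - 1) p"
      using measure_pmf.prob_compl[of "{..k - 1}" "binomial_pmf N p"]
        binomial_pmf_prob_atMost[of p N "k - 1"] assms by (simp add: Compl_eq_Diff_UNIV)
    ultimately show ?thesis
      using S by simp
  qed
qed

text \<open>Union bound: each of the two ways to miss \<open>p\<close> has probability below
  \<open>\<delta> / 2\<close>.\<close>

lemma binomial_pmf_coverage: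
  assumes "0 < \<delta>" "\<delta> < 1" "0 < N" "0 < p" "p < 1"
  shows "measure_pmf.prob (binomial_pmf N p) {k. lower_limit N \<delta> k < p \<and> p < upper_limit N \<delta> k} > 1 - \<delta>"
proof -
  let ?D = "binomial_pmf N p"
  let ?A = "{k. p \<le> lower_limit N \<delta> k}" and ?B = "{k. upper_limit N \<delta> k \<le> p}"
  have eq: "{k. lower_limit N \<delta> k < p \<and> p < upper_limit N \<delta> k} = UNIV - (?A \<union> ?B)"
    by auto
  have "measure_pmf.prob ?D (?A \<union> ?B) \<le> measure_pmf.prob ?D ?A + measure_pmf.prob ?D ?B"
    by (intro measure_Un_le) auto
  also have "\<dots> < \<delta>"
    using binomial_pmf_prob_le_lower_limit[OF assms] binomial_pmf_prob_upper_limit_le[OF assms] by simp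
  finally show ?thesis
    unfolding eq using measure_pmf.prob_compl[of "?A \<union> ?B" ?D] by simp
qed

theorem theorem1:
  fixes N :: nat and \<delta> :: real
  assumes "N \<ge> 1" and "0 < \<delta>" and "\<delta> < 1"
  shows "(\<forall>(p :: real) (M :: 'a measure) (K :: 'a \<Rightarrow> nat).
            0 < p \<longrightarrow> p < 1 \<longrightarrow> prob_space M \<longrightarrow>
            K \<in> measurable M (count_space UNIV) \<longrightarrow>
            distr M (count_space UNIV) K = measure_pmf (binomial_pmf N p) \<longrightarrow>
            measure M {\<omega> \<in> space M. lower_limit N \<delta> (K \<omega>) < p \<and> p < upper_limit N \<delta> (K \<omega>)}
              > 1 - \<delta>)
       \<and> (\<forall>k \<le> N.
            lower_limit N \<delta> k \<le> CP_lower N k \<delta> \<and>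
            (k \<noteq> 0 \<longrightarrow> lower_limit N \<delta> k < CP_lower N k \<delta>) \<and>
            CP_lower N k \<delta> < CP_upper N k \<delta> \<and>
            CP_upper N k \<delta> \<le> upper_limit N \<delta> k \<and>
            (k \<noteq> N \<longrightarrow> CP_upper N k \<delta> < upper_limit N \<delta> k))"
proof (intro conjI allI impI)
  fix p :: real and M :: "'a measure" and K :: "'a \<Rightarrow> nat"
  assume p: "0 < p" "p < 1" and K: "K \<in> measurable M (count_space UNIV)"
    and D: "distr M (count_space UNIV) K = measure_pmf (binomial_pmf N p)"
  let ?S = "{k. lower_limit N \<delta> k < p \<and> p < upper_limit N \<delta> k}"
  have "measure (distr M (count_space UNIV) K) ?S = measure M (K -` ?S \<inter> space M)"
    using K by (intro measure_distr) auto
  also have "K -` ?S \<inter> space M = {\<omega> \<in> space M. lower_limit N \<delta> (K \<omega>) < p \<and> p < upper_limit N \<delta> (K \<omega>)}"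
    by auto
  finally show "1 - \<delta> < measure M {\<omega> \<in> space M. lower_limit N \<delta> (K \<omega>) < p \<and> p < upper_limit N \<delta> (K \<omega>)}"
    using binomial_pmf_coverage[of \<delta> N p] assms p D by simp
next
  fix k assume k: "k \<le> N"
  show lower: "lower_limit N \<delta> k < CP_lower N k \<delta>" if "k \<noteq> 0"
    using that k assms by (intro lower_limit_less_CP_lower) auto
  show "lower_limit N \<delta> k \<le> CP_lower N k \<delta>"
    using lower lower_limit_0[of N \<delta>] by (cases "k = 0") auto
  show "CP_lower N k \<delta> < CP_upper N k \<delta>"
    using k assms by (intro CP_lower_less_CP_upper) auto
  show upper: "CP_upper N k \<delta> < upper_limit N \<delta> k" if "k \<noteq> N"
    using that k assms by (intro CP_upper_less_upper_limit) auto
  show "CP_upper N k \<delta> \<le> upper_limit N \<delta> k"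
    using upper upper_limit_N[of N \<delta>] assms by (cases "k = N") auto
qed

end
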